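(* Let $p$ be an odd prime, let $e \ge 1$ be an integer, and let $g, c$ be fixed integers with $p \nmid g$ and $p \nmid c$. Let $m = \operatorname{ord}_p(g)$ and $f(x) = x g^x - c$. Then the number of $x \in \{1, \dots, p^e m \mid x \not\equiv 0 \pmod p\}$ such that $f(x) \equiv 0 \pmod{p^e}$ is equal to $m$, and these solutions are all distinct modulo $m$.
   Context: $\operatorname{ord}_p(g)$ denotes the multiplicative order of $g$ modulo $p$. The notation $\{1,\dots,N \mid x\not\equiv 0 \pmod p\}$ denotes the set of integers $x$ with $1 \le x \le N$ and $p \nmid x$. *)

theory Defs
  imports "HOL-Number_Theory.Number_Theory"
begin

end

theory Submission
  imports Defs
begin

text \<open>
  With \<open>m\<close> the order of \<open>g\<close> modulo \<open>p\<close>, the residue of \<open>g ^ x\<close> modulo \<open>p ^ (k + 1)\<close> depends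
  only on \<open>x\<close> modulo \<open>p ^ k * m\<close>. As \<open>m\<close> divides \<open>p - 1\<close>, the residues of \<open>x\<close> modulo \<open>m\<close> and modulo
  powers of \<open>p\<close> are independent. Hence, within a fixed class modulo \<open>m\<close>, the solution modulo
  \<open>p ^ k\<close> determines \<open>g ^ x\<close> modulo \<open>p ^ (k + 1)\<close>, and \<open>x * g ^ x = c\<close> becomes a linear congruence
  with exactly one solution modulo \<open>p ^ (k + 1)\<close>.
\<close>

text \<open>Each \<open>p\<close>-th power gains a factor \<open>p\<close>: in
  \<open>b ^ p - 1 = (b - 1) * (\<Sum>i<p. b ^ i)\<close> the sum has \<open>p\<close> terms, all
  congruent to 1 modulo \<open>p\<close>.\<close>

lemma cong_one_power_prime_power:
  fixes a :: int and p k :: nat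
  assumes "[a = 1] (mod int p)"
  shows "[a ^ (p ^ k) = 1] (mod int p ^ Suc k)"
proof (induction k)
  case 0
  then show ?case using assms by simp
next
  case (Suc k)
  define b where "b = a ^ (p ^ k)"
  have b1: "int p ^ Suc k dvd b - 1"
    using Suc by (simp add: b_def cong_iff_dvd_diff)
  have "[b = 1] (mod int p)"
    using cong_pow[OF assms, of "p ^ k"] by (simp add: b_def)
  then have "[(\<Sum>i<p. b ^ i) = (\<Sum>i<p. 1)] (mod int p)"
    by (intro cong_sum) (metis cong_pow power_one)
  then have "int p dvd (\<Sum>i<p. b ^ i)"
    by (simp add: cong_dvd_iff)
  with b1 have "int p ^ Suc k * int p dvd (b - 1) * (\<Sum>i<p. b ^ i)"
    by (rule mult_dvd_mono)
  also have "(b - 1) * (\<Sum>i<p. b ^ i) = b ^ p - 1"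
    by (simp add: power_diff_1_eq)
  also have "b ^ p = a ^ (p ^ Suc k)"
    by (simp add: b_def power_mult [symmetric] mult.commute)
  finally show ?case
    by (simp add: cong_iff_dvd_diff mult.commute)
qed

text \<open>The modulus of the conclusion has one more factor \<open>p\<close> than that of the
  exponents; this gain drives each lifting step below.\<close>

lemma cong_power_exponent:
  fixes g :: int and p m k x y :: nat
  assumes g: "[g ^ m = 1] (mod int p)" and xy: "[x = y] (mod p ^ k * m)"
  shows "[g ^ x = g ^ y] (mod int p ^ Suc k)"
proof -
  have one: "[g ^ (p ^ k * m * q) = 1] (mod int p ^ Suc k)" for q
  proof -
    have "[(g ^ m) ^ (p ^ k) = 1] (mod int p ^ Suc k)"
      by (rule cong_one_power_prime_power[OF g])
    then have "[((g ^ m) ^ (p ^ k)) ^ q = 1 ^ q] (mod int p ^ Suc k)"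
      by (rule cong_pow)
    then show ?thesis
      by (simp add: power_mult [symmetric] mult_ac)
  qed
  \<comment> \<open>Multiples of the period are added on both sides, so neither an order between
    \<open>x\<close> and \<open>y\<close> nor truncated subtraction enters.\<close>
  from xy obtain q1 q2 where "y + q1 * (p ^ k * m) = x + q2 * (p ^ k * m)"
    unfolding cong_iff_lin_nat by metis
  then have "g ^ y * g ^ (p ^ k * m * q1) = g ^ x * g ^ (p ^ k * m * q2)"
    by (metis mult.commute power_add)
  then show ?thesis
    using cong_scalar_left[OF one[of q1], of "g ^ y"] cong_scalar_left[OF one[of q2], of "g ^ x"]
    by (metis cong_sym cong_trans mult.right_neutral)
qed

lemma ord_int_prime:
  fixes p :: nat and g :: int
  assumes p: "prime p" and g: "\<not> int p dvd g"
  shows "ord (int p) g > 0" "[g ^ ord (int p) g = 1] (mod int p)" "coprime (ord (int p) g) p"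
proof -
  define a where "a = nat (g mod int p)"
  have p0: "p > 0" using p by (simp add: prime_gt_0_nat)
  have a: "int a = g mod int p" using p0 by (simp add: a_def)
  have ga: "[g = int a] (mod int p)" by (simp add: a)
  have cop: "coprime (int p) g"
    using p g by (simp add: prime_imp_coprime)
  then have cop': "coprime p a"
    using ga by (metis cong_imp_coprime coprime_commute coprime_int_iff)
  have eq: "[g ^ d = 1] (mod int p) \<longleftrightarrow> [a ^ d = 1] (mod p)" for d
  proof -
    have "[g ^ d = 1] (mod int p) \<longleftrightarrow> [int (a ^ d) = int 1] (mod int p)"
      using cong_pow[OF ga, of d] by (auto simp: cong_def)
    then show ?thesis unfolding cong_int_iff .
  qed
  have o: "ord (int p) g = ord p a"
    unfolding ord_def eq using cop cop' by simp
  show "ord (int p) g > 0" "[g ^ ord (int p) g = 1] (mod int p)"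
    unfolding o eq using cop' ord[of a p] by auto
  \<comment> \<open>Fermat bounds the order by a divisor of \<open>p - 1\<close>, which is coprime
    to \<open>p\<close>.\<close>
  have "ord p a dvd p - 1"
    using order_divides_totient[OF cop'] p by (simp add: totient_prime)
  moreover have "coprime (p - 1) p"
    using p0 by (metis Suc_pred' coprime_Suc_right_nat coprime_commute coprime_Suc_left_nat)
  ultimately show "coprime (ord (int p) g) p"
    unfolding o by (metis coprime_divisors dvd_refl)
qed

context
  fixes p m :: nat and g c :: int
  assumes p0: "p > 0" and cop_g: "coprime g (int p)"
    and gm: "[g ^ m = 1] (mod int p)" and cop_m: "coprime m p"
begin

text \<open>Lifting by induction on \<open>k\<close>: the power \<open>g ^ x\<close> of the old
  solution is frozen, the resulting linear congruence is solved for \<open>y\<close>, and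
  \<open>g ^ y\<close> then turns out to agree with \<open>g ^ x\<close>.\<close>

lemma ex_solution_in_class:
  "\<exists>x. [x = r] (mod m) \<and> [int x * g ^ x = c] (mod int p ^ k)"
proof (induction k)
  case 0
  show ?case by (intro exI[of _ r]) simp
next
  case (Suc k)
  then obtain x where x: "[x = r] (mod m)" "[int x * g ^ x = c] (mod int p ^ k)"
    by blast
  have "coprime (g ^ x) (int p ^ Suc k)"
    using cop_g by (intro coprime_power_left_iff[THEN iffD2] coprime_power_right_iff[THEN iffD2]) auto
  then obtain h where h: "[g ^ x * h = 1] (mod int p ^ Suc k)"
    using cong_solve_coprime_int by blast
  \<comment> \<open>\<open>h\<close> inverts \<open>g ^ x\<close>, so \<open>c * h\<close> solves
    the linear congruence; its nonnegative residue can serve as an exponent.\<close>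
  define u where "u = nat ((c * h) mod int p ^ Suc k)"
  have u: "[int u = c * h] (mod int p ^ Suc k)"
    using p0 by (simp add: u_def)
  have "coprime m (p ^ Suc k)"
    using cop_m by simp
  then obtain y where y: "[y = r] (mod m)" "[y = u] (mod p ^ Suc k)"
    using binary_chinese_remainder_nat by blast
  have "[int y = int u] (mod int p ^ Suc k)"
    using y(2) by (metis cong_int_iff of_nat_power)
  then have yc: "[int y = c * h] (mod int p ^ Suc k)"
    using u by (rule cong_trans)
  then have "[int y * g ^ x = c * (g ^ x * h)] (mod int p ^ Suc k)"
    by (metis cong_scalar_right mult.assoc mult.commute)
  then have ygx: "[int y * g ^ x = c] (mod int p ^ Suc k)"
    using cong_scalar_left[OF h, of c] by (metis cong_trans mult.right_neutral)
  \<comment> \<open>Modulo \<open>p ^ k\<close> both \<open>y\<close> and \<open>x\<close> solve the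
    same linear congruence, and the unit \<open>g ^ x\<close> cancels.\<close>
  then have "[int y * g ^ x = c] (mod int p ^ k)"
    by (rule cong_dvd_modulus) simp
  then have "[int y * g ^ x = int x * g ^ x] (mod int p ^ k)"
    using x(2) cong_sym cong_trans by blast
  then have "[int y = int x] (mod int p ^ k)"
    using cop_g by (subst (asm) cong_mult_rcancel) auto
  then have "[y = x] (mod p ^ k)"
    by (metis cong_int_iff of_nat_power)
  moreover have "[y = x] (mod m)"
    using x(1) y(1) cong_sym cong_trans by blast
  ultimately have "[y = x] (mod p ^ k * m)"
    using cop_m by (intro coprime_cong_mult_nat) (auto simp: coprime_commute)
  then have "[g ^ y = g ^ x] (mod int p ^ Suc k)"
    by (rule cong_power_exponent[OF gm])
  then have "[int y * g ^ y = c] (mod int p ^ Suc k)"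
    using ygx cong_scalar_left cong_trans by blast
  with y(1) show ?case by blast
qed

text \<open>Agreement climbs one power of \<open>p\<close> at a time: congruence modulo
  \<open>p ^ j * m\<close> equates the powers of \<open>g\<close> modulo \<open>p ^ Suc j\<close>,
  and cancelling them equates \<open>x\<close> and \<open>y\<close> there.\<close>

lemma solution_unique_in_class:
  assumes xy: "[x = y] (mod m)"
    and x: "[int x * g ^ x = c] (mod int p ^ k)" and y: "[int y * g ^ y = c] (mod int p ^ k)"
  shows "[x = y] (mod p ^ k * m)"
proof -
  have "[x = y] (mod p ^ j)" if "j \<le> k" for j
    using that
  proof (induction j)
    case 0
    show ?case by simp
  next
    case (Suc j)
    then have "[x = y] (mod p ^ j * m)"
      using xy cop_m by (intro coprime_cong_mult_nat) (auto simp: coprime_commute)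
    then have g: "[g ^ x = g ^ y] (mod int p ^ Suc j)"
      by (rule cong_power_exponent[OF gm])
    have "int p ^ Suc j dvd int p ^ k"
      using Suc.prems by (rule le_imp_power_dvd)
    then have "[int x * g ^ x = int y * g ^ y] (mod int p ^ Suc j)"
      using x y by (meson cong_dvd_modulus cong_sym cong_trans)
    then have "[int x * g ^ x = int y * g ^ x] (mod int p ^ Suc j)"
      using g by (meson cong_scalar_left cong_sym cong_trans)
    then have "[int x = int y] (mod int p ^ Suc j)"
      using cop_g by (subst (asm) cong_mult_rcancel) auto
    then show ?case
      by (metis cong_int_iff of_nat_power)
  qed
  then show ?thesis
    using xy cop_m by (intro coprime_cong_mult_nat) (auto simp: coprime_commute)
qed

text \<open>This periodicity allows a solution to be moved into the interval where solutions are
  counted.\<close>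

lemma solution_cong:
  assumes "[x = y] (mod p ^ k * m)" "[int x * g ^ x = c] (mod int p ^ k)"
  shows "[int y * g ^ y = c] (mod int p ^ k)"
proof -
  have "[x = y] (mod p ^ k)"
    using assms(1) by (rule cong_dvd_modulus_nat) simp
  then have "[int x = int y] (mod int p ^ k)"
    by (metis cong_int_iff of_nat_power)
  moreover have "[g ^ x = g ^ y] (mod int p ^ k)"
    using cong_power_exponent[OF gm assms(1)] by (rule cong_dvd_modulus) simp
  ultimately have "[int x * g ^ x = int y * g ^ y] (mod int p ^ k)"
    by (rule cong_mult)
  then show ?thesis
    using assms(2) by (meson cong_sym cong_trans)
qed

text \<open>Uniqueness in a class gives injectivity and existence gives surjectivity. The bijection
  yields both the count and the distinctness modulo \<open>m\<close>.\<close>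

lemma bij_betw_solutions_classes:
  assumes m0: "m > 0"
  shows "bij_betw (\<lambda>x. x mod m) {x \<in> {1..p ^ k * m}. [int x * g ^ x = c] (mod int p ^ k)} {..<m}"
    (is "bij_betw _ ?S _")
proof (rule bij_betw_imageI)
  let ?N = "p ^ k * m"
  show "inj_on (\<lambda>x. x mod m) ?S"
  proof (rule inj_onI)
    fix x y assume S: "x \<in> ?S" "y \<in> ?S" and "x mod m = y mod m"
    then have "[x = y] (mod ?N)"
      by (intro solution_unique_in_class) (auto simp: cong_def)
    then have "[int x = int y] (mod int ?N)"
      by (simp only: cong_int_iff)
    then have "int ?N dvd int x - int y"
      by (simp only: cong_iff_dvd_diff)
    moreover have "\<bar>int x - int y\<bar> < int ?N"
    proof -
      have "1 \<le> x" "x \<le> ?N" "1 \<le> y" "y \<le> ?N" using S by auto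
      then show ?thesis by linarith
    qed
    ultimately show "x = y"
      using dvd_imp_le_int[of "int x - int y" "int ?N"] by fastforce
  qed
  show "(\<lambda>x. x mod m) ` ?S = {..<m}"
  proof
    show "(\<lambda>x. x mod m) ` ?S \<subseteq> {..<m}" using m0 by auto
    show "{..<m} \<subseteq> (\<lambda>x. x mod m) ` ?S"
    proof
      fix r assume r: "r \<in> {..<m}"
      obtain x where x: "[x = r] (mod m)" "[int x * g ^ x = c] (mod int p ^ k)"
        using ex_solution_in_class by blast
      have N0: "?N > 0" using p0 m0 by simp
      \<comment> \<open>The interval starts at 1, so the residue 0 is represented by
        \<open>?N\<close>.\<close>
      define y where "y = (if x mod ?N = 0 then ?N else x mod ?N)"
      have y: "[x = y] (mod ?N)"
        by (simp add: y_def cong_def)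
      have "y \<in> {1..?N}"
        using N0 by (auto simp: y_def Suc_le_eq intro: less_imp_le)
      moreover have "[int y * g ^ y = c] (mod int p ^ k)"
        by (rule solution_cong[OF y x(2)])
      moreover have "[x = y] (mod m)"
        using y by (rule cong_dvd_modulus_nat) simp
      then have "r = y mod m"
        using x(1) r by (simp add: cong_def)
      ultimately show "r \<in> (\<lambda>x. x mod m) ` ?S" by blast
    qed
  qed
qed

end

theorem theorem9:
  fixes p e m :: nat and g c :: int and f :: "nat \<Rightarrow> int" and S :: "nat set"
  assumes "prime p" and "odd p" and "e \<ge> 1"
    and "\<not> int p dvd g" and "\<not> int p dvd c"
  defines "m \<equiv> ord (int p) g"
    and "f \<equiv> \<lambda>x. int x * g ^ x - c"
    and "S \<equiv> {x \<in> {1..p ^ e * m}. \<not> [x = 0] (mod p) \<and> [f x = 0] (mod int p ^ e)}"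
  shows "card S = m \<and> (\<forall>x\<in>S. \<forall>y\<in>S. x \<noteq> y \<longrightarrow> \<not> [x = y] (mod m))"
proof -
  have p0: "p > 0"
    using assms(1) by (rule prime_gt_0_nat)
  have "coprime (int p) g"
    using assms(1,4) by (simp add: prime_imp_coprime)
  then have cop_g: "coprime g (int p)"
    by (rule coprime_imp_coprime) auto
  note m = ord_int_prime[OF assms(1,4), folded m_def]
  \<comment> \<open>A solution divisible by \<open>p\<close> would force \<open>p\<close> to divide
    \<open>c\<close>; \<open>e \<ge> 1\<close> lets the congruence descend to the modulus
    \<open>p\<close>.\<close>
  have "\<not> [x = 0] (mod p)" if "[int x * g ^ x = c] (mod int p ^ e)" for x
  proof
    assume "[x = 0] (mod p)"
    then have "int p dvd int x * g ^ x"
      by (simp add: cong_0_iff)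
    moreover have "[int x * g ^ x = c] (mod int p)"
      using that by (rule cong_dvd_modulus) (use assms(3) in simp)
    ultimately show False
      using assms(5) by (metis cong_dvd_iff)
  qed
  then have "S = {x \<in> {1..p ^ e * m}. [int x * g ^ x = c] (mod int p ^ e)}"
    unfolding S_def f_def by (auto simp: cong_diff_iff_cong_0)
  then have bij: "bij_betw (\<lambda>x. x mod m) S {..<m}"
    using bij_betw_solutions_classes[OF p0 cop_g m(2,3,1)] by simp
  show ?thesis
    using bij_betw_same_card[OF bij] bij_betw_imp_inj_on[OF bij]
    by (auto simp: cong_def inj_on_def)
qed

end
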